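(* Let $p\ge 1$. For every $t\ge 0$ let $0<m_t\le L_t$, $\sigma_t\ge 0$, $c_t\ge 0$, $0\le\alpha_t\le \frac{2}{L_t}$, and let $f_t\in\mathcal S(m_t,L_t)$ with global minimizer $x_t^*\in\mathbb R^p$. Consider the inexact online gradient descent iteration $x_{t+1}=x_t-\alpha_t(\nabla f_t(x_t)+v_t)$ and assume $\|x_{t+1}^*-x_t^*\|\le\sigma_t$ and $\|v_t\|\le c_t$ for all $t$. Let $\mathcal T_t\subseteq\mathbb R_+^4$ be the set of tuples of non-negative scalars $(\rho_t,\lambda_t^{(1)},\lambda_t^{(2)},\lambda_t^{(3)})$ satisfying $$\begin{bmatrix}1-\rho_t^2-2\lambda_t^{(1)}L_tm_t & -\alpha_t+\lambda_t^{(1)}(L_t+m_t) & 1 & -\alpha_t\\ -\alpha_t+\lambda_t^{(1)}(L_t+m_t) & \alpha_t^2-2\lambda_t^{(1)} & -\alpha_t & \alpha_t^2\\ 1 & -\alpha_t & 1-\lambda_t^{(2)} & -\alpha_t\\ -\alpha_t & \alpha_t^2 & -\alpha_t & \alpha_t^2-\lambda_t^{(3)}\end{bmatrix}\preceq 0.$$ Let $\hat U_0=\|x_0-x_0^*\|^2$ and, for $t\ge0$, $$\hat U_{t+1}=\inf_{(\rho_t,\lambda_t^{(1)},\lambda_t^{(2)},\lambda_t^{(3)})\in\mathcal T_t}\left(\rho_t^2\hat U_t+\lambda_t^{(2)}\sigma_t^2+\lambda_t^{(3)}c_t^2\right).$$ Then for all $t\ge 0$, $$\hat U_{t+1}=\left(\mu_t\sqrt{\hat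 U_t}+\sigma_t+\alpha_tc_t\right)^2 .$$
   Context: $\mathcal S(m,L)$ is the set of differentiable functions $f:\mathbb R^p\to\mathbb R$ having a unique global minimizer $x^*$ such that for all $x\in\mathbb R^p$ $$\begin{bmatrix}x-x^*\\ \nabla f(x)\end{bmatrix}^T\begin{bmatrix}-2mLI_p&(L+m)I_p\\(L+m)I_p&-2I_p\end{bmatrix}\begin{bmatrix}x-x^*\\ \nabla f(x)\end{bmatrix}\ge0.$$ $\mu_t:=1-m_t\alpha_t$ if $0\le\alpha_t\le\frac{2}{m_t+L_t}$, and $\mu_t:=\alpha_tL_t-1$ if $\frac{2}{m_t+L_t}\le\alpha_t\le\frac{2}{L_t}$. $P\preceq0$ means the symmetric matrix $P$ is negative semidefinite; norms are Euclidean. *)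

theory Defs
  imports "HOL-Analysis.Analysis"
begin

definition is_global_minimizer :: "('a \<Rightarrow> real) \<Rightarrow> 'a \<Rightarrow> bool" where
  "is_global_minimizer f x \<longleftrightarrow> (\<forall>y. f x \<le> f y)"

definition gradient :: "('a::real_inner \<Rightarrow> real) \<Rightarrow> 'a \<Rightarrow> 'a" where
  "gradient f x = (THE D. GDERIV f x :> D)"

definition stack_vec :: "real ^ 'n \<Rightarrow> real ^ 'n \<Rightarrow> real ^ ('n::finite + 'n)" where
  "stack_vec a b = (\<chi> i. case i of Inl j \<Rightarrow> a $ j | Inr j \<Rightarrow> b $ j)"

definition block_matrix ::
  "real ^ 'n ^ 'n \<Rightarrow> real ^ 'n ^ 'n \<Rightarrow> real ^ 'n ^ 'n \<Rightarrow> real ^ 'n ^ 'n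
     \<Rightarrow> real ^ ('n::finite + 'n) ^ ('n + 'n)" where
  "block_matrix A B C D =
     (\<chi> i. case i of Inl j \<Rightarrow> stack_vec (A $ j) (B $ j)
                   | Inr j \<Rightarrow> stack_vec (C $ j) (D $ j))"

text \<open>Here \<open>mat c\<close> is \<open>c\<close> times the identity matrix.\<close>

definition S_class :: "real \<Rightarrow> real \<Rightarrow> (real ^ 'n::finite \<Rightarrow> real) set" where
  "S_class m L =
     {f. (\<forall>x. f differentiable (at x)) \<and>
         (\<exists>!xs. is_global_minimizer f xs) \<and>
         (\<forall>xs. is_global_minimizer f xs \<longrightarrow>
            (\<forall>x. let z = stack_vec (x - xs) (gradient f x) in
               z \<bullet> (block_matrix (mat (- 2 * m * L)) (mat (L + m))
                                (mat (L + m))       (mat (- 2)) *v z) \<ge> 0))}"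

text \<open>The two ranges of the step size overlap only at \<open>\<alpha> = 2 / (m + L)\<close>, where both
  formulas give \<open>(L - m) / (L + m)\<close>. The second formula is meant for
  \<open>2 / (m + L) \<le> \<alpha> \<le> 2 / L\<close>.\<close>

definition contraction_factor :: "real \<Rightarrow> real \<Rightarrow> real \<Rightarrow> real" where
  "contraction_factor m L \<alpha> = (if \<alpha> \<le> 2 / (m + L) then 1 - m * \<alpha> else \<alpha> * L - 1)"

definition neg_semidef :: "real ^ 'k ^ 'k::finite \<Rightarrow> bool" where
  "neg_semidef P \<longleftrightarrow> transpose P = P \<and> (\<forall>z. z \<bullet> (P *v z) \<le> 0)"

definition lmi_matrix ::
  "real \<Rightarrow> real \<Rightarrow> real \<Rightarrow> real \<Rightarrow> real \<Rightarrow> real \<Rightarrow> real \<Rightarrow> real ^ 4 ^ 4" where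
  "lmi_matrix m L \<alpha> \<rho> l1 l2 l3 = vector
     [vector [1 - \<rho>\<^sup>2 - 2 * l1 * L * m, - \<alpha> + l1 * (L + m), 1, - \<alpha>],
      vector [- \<alpha> + l1 * (L + m), \<alpha>\<^sup>2 - 2 * l1, - \<alpha>, \<alpha>\<^sup>2],
      vector [1, - \<alpha>, 1 - l2, - \<alpha>],
      vector [- \<alpha>, \<alpha>\<^sup>2, - \<alpha>, \<alpha>\<^sup>2 - l3]]"

definition lmi_feasible :: "real \<Rightarrow> real \<Rightarrow> real \<Rightarrow> (real \<times> real \<times> real \<times> real) set" where
  "lmi_feasible m L \<alpha> =
     {(\<rho>, l1, l2, l3). 0 \<le> \<rho> \<and> 0 \<le> l1 \<and> 0 \<le> l2 \<and> 0 \<le> l3 \<and>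
        neg_semidef (lmi_matrix m L \<alpha> \<rho> l1 l2 l3)}"

text \<open>The infimum is taken in the reals. The objective is nonnegative on the feasible set
  as long as \<open>U \<ge> 0\<close>, and for \<open>0 < m \<le> L\<close> the feasible set is nonempty (take all four
  scalars large), so it is a genuine infimum.\<close>

primrec U_hat ::
  "(nat \<Rightarrow> real) \<Rightarrow> (nat \<Rightarrow> real) \<Rightarrow> (nat \<Rightarrow> real) \<Rightarrow> (nat \<Rightarrow> real) \<Rightarrow> (nat \<Rightarrow> real)
     \<Rightarrow> real \<Rightarrow> nat \<Rightarrow> real" where
  "U_hat m L \<alpha> \<sigma> c U0 0 = U0"
| "U_hat m L \<alpha> \<sigma> c U0 (Suc t) =
     (INF (\<rho>, l1, l2, l3) \<in> lmi_feasible (m t) (L t) (\<alpha> t).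
        \<rho>\<^sup>2 * U_hat m L \<alpha> \<sigma> c U0 t + l2 * (\<sigma> t)\<^sup>2 + l3 * (c t)\<^sup>2)"

end

theory Submission
  imports Defs
begin

text \<open>
  The quadratic form of the matrix inequality is
  \<open>(a - \<alpha> g + d - \<alpha> e)\<^sup>2 - \<rho>\<^sup>2 a\<^sup>2 - \<lambda>\<^sub>2 d\<^sup>2 - \<lambda>\<^sub>3 e\<^sup>2 + 2 \<lambda>\<^sub>1 (g - m a) (L a - g)\<close>.
  Evaluating it at \<open>a = \<surd>U\<close>, \<open>d = \<plusminus>\<sigma>\<close>, \<open>e = \<minusplus>c\<close> and at the root \<open>g = m a\<close> or \<open>g = L a\<close> of the
  last term bounds the objective from below by \<open>(\<mu> \<surd>U + \<sigma> + \<alpha> c)\<^sup>2\<close>. Conversely,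
  Cauchy--Schwarz with weights nearly proportional to \<open>\<mu> \<surd>U\<close>, \<open>\<sigma>\<close>, \<open>\<alpha> c\<close> splits the square
  into three, and the part \<open>(a - \<alpha> g)\<^sup>2\<close> is absorbed by a suitable \<open>\<lambda>\<^sub>1\<close>. The infimum need not
  be attained (a weight may vanish, or \<open>m = L\<close>), so everything is perturbed by \<open>\<epsilon> > 0\<close>.
\<close>

section \<open>The matrix inequality as a quadratic form inequality\<close>

lemma vector_4 [simp]:
  "(vector [w, x, y, z] :: 'a::zero ^ 4) $ 1 = w"
  "(vector [w, x, y, z] :: 'a ^ 4) $ 2 = x"
  "(vector [w, x, y, z] :: 'a ^ 4) $ 3 = y"
  "(vector [w, x, y, z] :: 'a ^ 4) $ 4 = z"
  unfolding vector_def by simp_all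

lemma neg_semidef_lmi_matrix_iff:
  "neg_semidef (lmi_matrix m L \<alpha> \<rho> l1 l2 l3) \<longleftrightarrow>
     (\<forall>a g d e. (a - \<alpha> * g + d - \<alpha> * e)\<^sup>2 + 2 * l1 * ((g - m * a) * (L * a - g))
                \<le> \<rho>\<^sup>2 * a\<^sup>2 + l2 * d\<^sup>2 + l3 * e\<^sup>2)"
proof -
  let ?M = "lmi_matrix m L \<alpha> \<rho> l1 l2 l3"
  have sym: "transpose ?M = ?M"
    by (simp add: vec_eq_iff forall_4 transpose_def lmi_matrix_def)
  have form: "z \<bullet> (?M *v z) =
      (z $ 1 - \<alpha> * z $ 2 + z $ 3 - \<alpha> * z $ 4)\<^sup>2
        + 2 * l1 * ((z $ 2 - m * z $ 1) * (L * z $ 1 - z $ 2))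
        - (\<rho>\<^sup>2 * (z $ 1)\<^sup>2 + l2 * (z $ 3)\<^sup>2 + l3 * (z $ 4)\<^sup>2)" for z
    by (simp add: inner_vec_def matrix_vector_mult_def sum_4 lmi_matrix_def
        power2_eq_square algebra_simps)
  show ?thesis
  proof
    assume nsd: "neg_semidef ?M"
    show "\<forall>a g d e. (a - \<alpha> * g + d - \<alpha> * e)\<^sup>2 + 2 * l1 * ((g - m * a) * (L * a - g))
            \<le> \<rho>\<^sup>2 * a\<^sup>2 + l2 * d\<^sup>2 + l3 * e\<^sup>2"
    proof (intro allI)
      fix a g d e
      have "vector [a, g, d, e] \<bullet> (?M *v vector [a, g, d, e]) \<le> 0"
        using nsd by (simp add: neg_semidef_def)
      then show "(a - \<alpha> * g + d - \<alpha> * e)\<^sup>2 + 2 * l1 * ((g - m * a) * (L * a - g))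
          \<le> \<rho>\<^sup>2 * a\<^sup>2 + l2 * d\<^sup>2 + l3 * e\<^sup>2"
        by (simp add: form)
    qed
  next
    assume "\<forall>a g d e. (a - \<alpha> * g + d - \<alpha> * e)\<^sup>2 + 2 * l1 * ((g - m * a) * (L * a - g))
      \<le> \<rho>\<^sup>2 * a\<^sup>2 + l2 * d\<^sup>2 + l3 * e\<^sup>2"
    then show "neg_semidef ?M"
      unfolding neg_semidef_def form using sym by (simp add: diff_le_0_iff_le)
  qed
qed

lemma lmi_feasible_iff:
  "(\<rho>, l1, l2, l3) \<in> lmi_feasible m L \<alpha> \<longleftrightarrow>
     0 \<le> \<rho> \<and> 0 \<le> l1 \<and> 0 \<le> l2 \<and> 0 \<le> l3 \<and>
     (\<forall>a g d e. (a - \<alpha> * g + d - \<alpha> * e)\<^sup>2 + 2 * l1 * ((g - m * a) * (L * a - g))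
                \<le> \<rho>\<^sup>2 * a\<^sup>2 + l2 * d\<^sup>2 + l3 * e\<^sup>2)"
  by (simp add: lmi_feasible_def neg_semidef_lmi_matrix_iff)

section \<open>The contraction factor and the lower bound\<close>

text \<open>The factor is the maximum of \<open>1 - m * \<alpha>\<close> and
  \<open>\<alpha> * L - 1\<close>, hence at least half of their sum
  \<open>\<alpha> * (L - m)\<close>.\<close>

lemma contraction_factor_ge:
  fixes m L \<alpha> :: real
  assumes "0 < m" "m \<le> L"
  shows "\<alpha> * (L - m) \<le> 2 * contraction_factor m L \<alpha>"
  using assms by (auto simp: contraction_factor_def field_simps)

lemma contraction_factor_nonneg:
  fixes m L \<alpha> :: real
  assumes "0 < m" "m \<le> L" "0 \<le> \<alpha>"
  shows "0 \<le> contraction_factor m L \<alpha>"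
proof -
  have "0 \<le> \<alpha> * (L - m)"
    using assms by simp
  then show ?thesis
    using contraction_factor_ge[OF assms(1,2), of \<alpha>] by linarith
qed

lemma lmi_objective_ge:
  fixes m L \<alpha> U s c :: real
  assumes feas: "(\<rho>, l1, l2, l3) \<in> lmi_feasible m L \<alpha>" and U: "0 \<le> U"
  shows "(contraction_factor m L \<alpha> * sqrt U + s + \<alpha> * c)\<^sup>2 \<le> \<rho>\<^sup>2 * U + l2 * s\<^sup>2 + l3 * c\<^sup>2"
proof -
  have form: "(a - \<alpha> * g + d - \<alpha> * e)\<^sup>2 + 2 * l1 * ((g - m * a) * (L * a - g))
      \<le> \<rho>\<^sup>2 * a\<^sup>2 + l2 * d\<^sup>2 + l3 * e\<^sup>2" for a g d e
    using feas by (simp add: lmi_feasible_iff)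
  show ?thesis
  proof (cases "\<alpha> \<le> 2 / (m + L)")
    case True
    then show ?thesis
      \<comment> \<open>At \<open>g = m * a\<close> the residual \<open>a - \<alpha> * g\<close> is
        \<open>(1 - m * \<alpha>) * a\<close>; taking \<open>e = - c\<close> makes the noise enter
        with a plus sign.\<close>
      using form[of "sqrt U" "m * sqrt U" s "- c"] U
      by (simp add: contraction_factor_def algebra_simps)
  next
    case False
    \<comment> \<open>At \<open>g = L * a\<close> the residual is
      \<open>- (\<alpha> * L - 1) * a\<close>, so \<open>d\<close> and \<open>e\<close> change sign
      to stay aligned with it.\<close>
    have "(sqrt U - \<alpha> * (L * sqrt U) + - s - \<alpha> * c)\<^sup>2 =
        ((\<alpha> * L - 1) * sqrt U + s + \<alpha> * c)\<^sup>2"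
      by (simp add: power2_eq_square algebra_simps)
    then show ?thesis
      using False form[of "sqrt U" "L * sqrt U" "- s" c] U
      by (simp add: contraction_factor_def)
  qed
qed

section \<open>Multipliers for the gradient step\<close>

text \<open>For \<open>K = 0\<close> and \<open>\<mu> \<alpha> > 0\<close> no multiplier works with \<open>\<delta> = 0\<close>.\<close>

lemma multiplier_exists:
  fixes \<mu> \<alpha> K \<delta> :: real
  assumes "0 \<le> \<mu>" "0 \<le> \<alpha>" "0 \<le> K" "\<alpha> * K \<le> 2 * \<mu>" "0 < \<delta>"
  obtains l where "0 \<le> l"
    "\<And>a h. (\<mu> * a - \<alpha> * h)\<^sup>2 + 2 * l * (h * (K * a - h)) \<le> (\<mu>\<^sup>2 + \<delta>) * a\<^sup>2"
proof (cases "K = 0")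
  case True
  \<comment> \<open>The value at which the discriminant in \<open>(a, h)\<close> vanishes, so that
    the gap is a perfect square over \<open>\<delta>\<close>.\<close>
  define l where "l = (\<alpha>\<^sup>2 + \<mu>\<^sup>2 * \<alpha>\<^sup>2 / \<delta>) / 2"
  show thesis
  proof
    show "0 \<le> l"
      using assms by (simp add: l_def)
    fix a h
    have "(\<mu>\<^sup>2 + \<delta>) * a\<^sup>2 - ((\<mu> * a - \<alpha> * h)\<^sup>2 + 2 * l * (h * (K * a - h)))
        = (\<delta> * a + \<mu> * \<alpha> * h)\<^sup>2 / \<delta>"
      using True \<open>0 < \<delta>\<close> by (simp add: l_def power2_eq_square field_simps)
    also have "\<dots> \<ge> 0"
      using \<open>0 < \<delta>\<close> by simp
    finally show "(\<mu> * a - \<alpha> * h)\<^sup>2 + 2 * l * (h * (K * a - h)) \<le> (\<mu>\<^sup>2 + \<delta>) * a\<^sup>2"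
      by simp
  qed
next
  case False
  with assms have K: "0 < K" by simp
  \<comment> \<open>This choice cancels the cross term \<open>a * h\<close>; the remaining
    coefficient of \<open>h\<^sup>2\<close> has the right sign because
    \<open>\<alpha> * K \<le> 2 * \<mu>\<close>.\<close>
  define l where "l = \<mu> * \<alpha> / K"
  have lK: "l * K = \<mu> * \<alpha>"
    using K by (simp add: l_def)
  have "\<alpha> * (\<alpha> * K) \<le> \<alpha> * (2 * \<mu>)"
    using assms by (intro mult_left_mono)
  then have le: "\<alpha>\<^sup>2 \<le> 2 * l"
    using K by (simp add: l_def field_simps power2_eq_square)
  show thesis
  proof
    show "0 \<le> l"
      using assms K by (simp add: l_def)
    fix a h
    have "(\<mu> * a - \<alpha> * h)\<^sup>2 + 2 * l * (h * (K * a - h))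
        = \<mu>\<^sup>2 * a\<^sup>2 + 2 * (l * K - \<mu> * \<alpha>) * a * h - (2 * l - \<alpha>\<^sup>2) * h\<^sup>2"
      by (simp add: power2_eq_square algebra_simps)
    also have "\<dots> = \<mu>\<^sup>2 * a\<^sup>2 - (2 * l - \<alpha>\<^sup>2) * h\<^sup>2"
      by (simp add: lK)
    also have "\<dots> \<le> \<mu>\<^sup>2 * a\<^sup>2"
      using le by simp
    also have "\<dots> \<le> (\<mu>\<^sup>2 + \<delta>) * a\<^sup>2"
      using \<open>0 < \<delta>\<close> by (intro mult_right_mono) simp_all
    finally show "(\<mu> * a - \<alpha> * h)\<^sup>2 + 2 * l * (h * (K * a - h)) \<le> (\<mu>\<^sup>2 + \<delta>) * a\<^sup>2" .
  qed
qed

text \<open>Substituting \<open>h = g - m * a\<close> for short steps and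
  \<open>h = L * a - g\<close> for long ones reduces to \<open>multiplier_exists\<close> with
  \<open>K = L - m\<close>. The second substitution flips the sign of
  \<open>a - \<alpha> * g\<close>, which squaring hides, and swaps the two factors of the
  product.\<close>

lemma gradient_step_multiplier:
  fixes m L \<alpha> \<delta> :: real
  assumes "0 < m" "m \<le> L" "0 \<le> \<alpha>" "0 < \<delta>"
  obtains l where "0 \<le> l"
    "\<And>a g. (a - \<alpha> * g)\<^sup>2 + 2 * l * ((g - m * a) * (L * a - g))
             \<le> ((contraction_factor m L \<alpha>)\<^sup>2 + \<delta>) * a\<^sup>2"
proof -
  let ?\<mu> = "contraction_factor m L \<alpha>"
  obtain l where l: "0 \<le> l"
    and le: "\<And>a h. (?\<mu> * a - \<alpha> * h)\<^sup>2 + 2 * l * (h * ((L - m) * a - h)) \<le> (?\<mu>\<^sup>2 + \<delta>) * a\<^sup>2"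
    using multiplier_exists[of ?\<mu> \<alpha> "L - m" \<delta>] assms
      contraction_factor_nonneg[of m L \<alpha>] contraction_factor_ge[of m L \<alpha>] by auto
  show thesis
  proof
    show "0 \<le> l" by (fact l)
    fix a g
    show "(a - \<alpha> * g)\<^sup>2 + 2 * l * ((g - m * a) * (L * a - g)) \<le> (?\<mu>\<^sup>2 + \<delta>) * a\<^sup>2"
    proof (cases "\<alpha> \<le> 2 / (m + L)")
      case True
      then have "?\<mu> * a - \<alpha> * (g - m * a) = a - \<alpha> * g"
        by (simp add: contraction_factor_def algebra_simps)
      moreover have "(L - m) * a - (g - m * a) = L * a - g"
        by (simp add: algebra_simps)
      ultimately show ?thesis
        using le[of a "g - m * a"] by (simp only:)
    next
      case False
      then have "?\<mu> * a - \<alpha> * (L * a - g) = - (a - \<alpha> * g)"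
        by (simp add: contraction_factor_def algebra_simps)
      then have "(?\<mu> * a - \<alpha> * (L * a - g))\<^sup>2 = (a - \<alpha> * g)\<^sup>2"
        by (simp only: power2_minus)
      moreover have "(L - m) * a - (L * a - g) = g - m * a"
        by (simp add: algebra_simps)
      ultimately show ?thesis
        using le[of a "L * a - g"]
        by (simp only: mult.commute[of "L * a - g" "g - m * a"])
    qed
  qed
qed

section \<open>Nearly optimal feasible points\<close>

text \<open>Weighted Cauchy--Schwarz; by Lagrange's identity the gap is a sum of squares.\<close>

lemma power2_sum3_le_weighted:
  fixes p q r u v w :: real
  assumes "0 < p" "0 < q" "0 < r"
  shows "(u + v + w)\<^sup>2 \<le> (p + q + r) * (u\<^sup>2 / p + v\<^sup>2 / q + w\<^sup>2 / r)"
proof -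
  have "(p + q + r) * (u\<^sup>2 / p + v\<^sup>2 / q + w\<^sup>2 / r) - (u + v + w)\<^sup>2
      = (q * u - p * v)\<^sup>2 / (p * q) + (r * u - p * w)\<^sup>2 / (p * r) + (r * v - q * w)\<^sup>2 / (q * r)"
    using assms by (simp add: field_simps power2_eq_square)
  also have "\<dots> \<ge> 0"
    using assms by simp
  finally show ?thesis by simp
qed

lemma power2_div_add_le:
  fixes y \<epsilon> :: real
  assumes "0 \<le> y" "0 < \<epsilon>"
  shows "y\<^sup>2 / (y + \<epsilon>) \<le> y"
  using assms by (simp add: divide_simps power2_eq_square algebra_simps)

text \<open>The error has two sources: shifting the three weights by \<open>\<epsilon>\<close> costs
  \<open>3 * \<epsilon> * S\<close>, and the slack in \<open>\<rho>\<^sup>2\<close> costs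
  \<open>\<epsilon> * U\<close>.\<close>

lemma lmi_objective_approx:
  fixes m L \<alpha> U s c \<epsilon> :: real
  assumes "0 < m" "m \<le> L" "0 \<le> \<alpha>" "0 \<le> U" "0 \<le> s" "0 \<le> c" "0 < \<epsilon>"
  defines "S \<equiv> contraction_factor m L \<alpha> * sqrt U + s + \<alpha> * c"
  obtains \<rho> l1 l2 l3 where "(\<rho>, l1, l2, l3) \<in> lmi_feasible m L \<alpha>"
    "\<rho>\<^sup>2 * U + l2 * s\<^sup>2 + l3 * c\<^sup>2 \<le> S\<^sup>2 + \<epsilon> * (3 * S + U)"
proof -
  let ?\<mu> = "contraction_factor m L \<alpha>"
  have \<mu>: "0 \<le> ?\<mu>"
    using assms by (intro contraction_factor_nonneg)
  define p where "p = ?\<mu> * sqrt U + \<epsilon>"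
  define q where "q = s + \<epsilon>"
  define r where "r = \<alpha> * c + \<epsilon>"
  define T where "T = p + q + r"
  have pos: "0 < p" "0 < q" "0 < r"
    using assms \<mu> by (simp_all add: p_def q_def r_def add_nonneg_pos)
  then have T: "0 < T" by (simp add: T_def)
  have TS: "T = S + 3 * \<epsilon>"
    by (simp add: T_def S_def p_def q_def r_def)
  \<comment> \<open>Scaled so that, after multiplication by \<open>T / p\<close>, the slack in
    \<open>\<rho>\<^sup>2\<close> is exactly \<open>\<epsilon>\<close>.\<close>
  define \<delta> where "\<delta> = \<epsilon> * p / T"
  have \<delta>: "0 < \<delta>"
    using pos T assms by (simp add: \<delta>_def)
  obtain l where l: "0 \<le> l"
    and step: "\<And>a g. (a - \<alpha> * g)\<^sup>2 + 2 * l * ((g - m * a) * (L * a - g)) \<le> (?\<mu>\<^sup>2 + \<delta>) * a\<^sup>2"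
    using gradient_step_multiplier[OF assms(1-3) \<delta>] by blast
  define \<rho> where "\<rho> = sqrt (T / p * (?\<mu>\<^sup>2 + \<delta>))"
  have \<rho>2: "\<rho>\<^sup>2 = T / p * (?\<mu>\<^sup>2 + \<delta>)"
    using pos T \<delta> by (simp add: \<rho>_def)
  show thesis
  proof
    \<comment> \<open>Cauchy--Schwarz multiplies the gradient step by \<open>T / p\<close>, so its
      multiplier scales alike; the other two entries are the resulting coefficients of
      \<open>d\<^sup>2\<close> and \<open>e\<^sup>2\<close>.\<close>
    show "(\<rho>, T / p * l, T / q, T * \<alpha>\<^sup>2 / r) \<in> lmi_feasible m L \<alpha>"
      unfolding lmi_feasible_iff
    proof (intro conjI allI)
      show "0 \<le> \<rho>" "0 \<le> T / p * l" "0 \<le> T / q" "0 \<le> T * \<alpha>\<^sup>2 / r"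
        using pos T \<delta> l by (simp_all add: \<rho>_def)
      fix a g d e
      have "(a - \<alpha> * g + d - \<alpha> * e)\<^sup>2
          \<le> T * ((a - \<alpha> * g)\<^sup>2 / p + d\<^sup>2 / q + (- (\<alpha> * e))\<^sup>2 / r)"
        using power2_sum3_le_weighted[OF pos, of "a - \<alpha> * g" d "- (\<alpha> * e)"]
        by (simp add: T_def)
      then have "(a - \<alpha> * g + d - \<alpha> * e)\<^sup>2 + 2 * (T / p * l) * ((g - m * a) * (L * a - g))
          \<le> T / p * ((a - \<alpha> * g)\<^sup>2 + 2 * l * ((g - m * a) * (L * a - g)))
             + T / q * d\<^sup>2 + T * \<alpha>\<^sup>2 / r * e\<^sup>2"
        by (simp add: distrib_left power_mult_distrib mult.assoc mult.left_commute)
      also have "\<dots> \<le> T / p * ((?\<mu>\<^sup>2 + \<delta>) * a\<^sup>2) + T / q * d\<^sup>2 + T * \<alpha>\<^sup>2 / r * e\<^sup>2"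
        using step[of a g] pos T by (intro add_right_mono mult_left_mono) simp_all
      finally show "(a - \<alpha> * g + d - \<alpha> * e)\<^sup>2 + 2 * (T / p * l) * ((g - m * a) * (L * a - g))
          \<le> \<rho>\<^sup>2 * a\<^sup>2 + T / q * d\<^sup>2 + T * \<alpha>\<^sup>2 / r * e\<^sup>2"
        by (simp add: \<rho>2 mult.assoc)
    qed
    have "T / p * \<delta> = \<epsilon>"
      using pos T by (simp add: \<delta>_def)
    then have "\<rho>\<^sup>2 = T / p * ?\<mu>\<^sup>2 + \<epsilon>"
      by (simp add: \<rho>2 distrib_left)
    then have "\<rho>\<^sup>2 * U + T / q * s\<^sup>2 + T * \<alpha>\<^sup>2 / r * c\<^sup>2
        = T * ((?\<mu> * sqrt U)\<^sup>2 / p + s\<^sup>2 / q + (\<alpha> * c)\<^sup>2 / r) + \<epsilon> * U"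
      using \<open>0 \<le> U\<close> by (simp add: distrib_left distrib_right power_mult_distrib)
    \<comment> \<open>Each quotient has the form \<open>y\<^sup>2 / (y + \<epsilon>)\<close> and is
      at most \<open>y\<close>; the three values of \<open>y\<close> add up to
      \<open>S\<close>.\<close>
    also have "\<dots> \<le> T * S + \<epsilon> * U"
      unfolding S_def p_def q_def r_def
      using assms \<mu> T by (intro add_right_mono mult_left_mono add_mono power2_div_add_le) simp_all
    also have "\<dots> = S\<^sup>2 + \<epsilon> * (3 * S + U)"
      by (simp add: TS power2_eq_square algebra_simps)
    finally show "\<rho>\<^sup>2 * U + T / q * s\<^sup>2 + T * \<alpha>\<^sup>2 / r * c\<^sup>2 \<le> S\<^sup>2 + \<epsilon> * (3 * S + U)" .
  qed
qed

section \<open>The value of the infimum and the recursion\<close>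

lemma lmi_value:
  fixes m L \<alpha> U s c :: real
  assumes "0 < m" "m \<le> L" "0 \<le> \<alpha>" "0 \<le> U" "0 \<le> s" "0 \<le> c"
  shows "(INF (\<rho>, l1, l2, l3) \<in> lmi_feasible m L \<alpha>. \<rho>\<^sup>2 * U + l2 * s\<^sup>2 + l3 * c\<^sup>2)
           = (contraction_factor m L \<alpha> * sqrt U + s + \<alpha> * c)\<^sup>2"
proof -
  define S where "S = contraction_factor m L \<alpha> * sqrt U + s + \<alpha> * c"
  define F where "F = (\<lambda>(\<rho>, l1 :: real, l2, l3). \<rho>\<^sup>2 * U + l2 * s\<^sup>2 + l3 * c\<^sup>2)"
  have S: "0 \<le> S"
    using assms contraction_factor_nonneg[of m L \<alpha>] by (simp add: S_def)
  have lower: "S\<^sup>2 \<le> F y" if "y \<in> lmi_feasible m L \<alpha>" for y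
    using that lmi_objective_ge[OF _ \<open>0 \<le> U\<close>]
    by (cases y) (auto simp: F_def S_def)
  have approx: "\<exists>y \<in> lmi_feasible m L \<alpha>. F y \<le> S\<^sup>2 + \<epsilon> * (3 * S + U)" if \<epsilon>: "0 < \<epsilon>" for \<epsilon>
  proof -
    obtain \<rho> l1 l2 l3 where "(\<rho>, l1, l2, l3) \<in> lmi_feasible m L \<alpha>"
      "\<rho>\<^sup>2 * U + l2 * s\<^sup>2 + l3 * c\<^sup>2 \<le> S\<^sup>2 + \<epsilon> * (3 * S + U)"
      using lmi_objective_approx[OF assms \<epsilon>] unfolding S_def by blast
    then show ?thesis
      by (intro bexI[of _ "(\<rho>, l1, l2, l3)"]) (simp_all add: F_def)
  qed
  have "lmi_feasible m L \<alpha> \<noteq> {}"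
    using approx[of 1] by auto
  then have "S\<^sup>2 \<le> Inf (F ` lmi_feasible m L \<alpha>)"
    using lower by (intro cINF_greatest)
  moreover have "Inf (F ` lmi_feasible m L \<alpha>) \<le> S\<^sup>2"
  proof (rule field_le_epsilon)
    fix e :: real
    assume e: "0 < e"
    \<comment> \<open>The summand 1 keeps the denominator positive when
      \<open>S = U = 0\<close>.\<close>
    define \<epsilon> where "\<epsilon> = e / (3 * S + U + 1)"
    have \<epsilon>: "0 < \<epsilon>" "\<epsilon> * (3 * S + U) \<le> e"
      using S \<open>0 \<le> U\<close> e by (simp_all add: \<epsilon>_def field_simps)
    obtain y where y: "y \<in> lmi_feasible m L \<alpha>" "F y \<le> S\<^sup>2 + \<epsilon> * (3 * S + U)"
      using approx[OF \<epsilon>(1)] by blast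
    have "Inf (F ` lmi_feasible m L \<alpha>) \<le> F y"
      using lower y(1) by (intro cINF_lower bdd_belowI2)
    then show "Inf (F ` lmi_feasible m L \<alpha>) \<le> S\<^sup>2 + e"
      using y(2) \<epsilon>(2) by linarith
  qed
  ultimately show ?thesis
    by (simp add: F_def S_def)
qed

theorem theorem3p2:
  fixes f :: "nat \<Rightarrow> real ^ 'p::finite \<Rightarrow> real"
    and x xs v :: "nat \<Rightarrow> real ^ 'p"
    and m L \<sigma> c \<alpha> :: "nat \<Rightarrow> real"
  assumes "\<And>t. 0 < m t" and "\<And>t. m t \<le> L t"
    and "\<And>t. 0 \<le> \<sigma> t" and "\<And>t. 0 \<le> c t"
    and "\<And>t. 0 \<le> \<alpha> t" and "\<And>t. \<alpha> t \<le> 2 / L t"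
    and "\<And>t. f t \<in> S_class (m t) (L t)"
    and "\<And>t. is_global_minimizer (f t) (xs t)"
    and "\<And>t. x (Suc t) = x t - \<alpha> t *\<^sub>R (gradient (f t) (x t) + v t)"
    and "\<And>t. norm (xs (Suc t) - xs t) \<le> \<sigma> t"
    and "\<And>t. norm (v t) \<le> c t"
  shows "\<forall>t. U_hat m L \<alpha> \<sigma> c ((norm (x 0 - xs 0))\<^sup>2) (Suc t) =
           (contraction_factor (m t) (L t) (\<alpha> t) *
              sqrt (U_hat m L \<alpha> \<sigma> c ((norm (x 0 - xs 0))\<^sup>2) t) + \<sigma> t + \<alpha> t * c t)\<^sup>2"
proof
  let ?U = "U_hat m L \<alpha> \<sigma> c ((norm (x 0 - xs 0))\<^sup>2)"
  have step: "?U (Suc t) = (contraction_factor (m t) (L t) (\<alpha> t) * sqrt (?U t) + \<sigma> t + \<alpha> t * c t)\<^sup>2"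
    if "0 \<le> ?U t" for t
    using lmi_value[OF assms(1,2,5) that assms(3,4)] by simp
  \<comment> \<open>The closed form needs a nonnegative previous value; this persists because the
    start and every later value are squares.\<close>
  have nonneg: "0 \<le> ?U t" for t
  proof (induction t)
    case 0
    show ?case by simp
  next
    case (Suc t)
    show ?case by (subst step[OF Suc]) simp
  qed
  show "?U (Suc t) = (contraction_factor (m t) (L t) (\<alpha> t) * sqrt (?U t) + \<sigma> t + \<alpha> t * c t)\<^sup>2" for t
    by (rule step[OF nonneg])
qed

end
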